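(* Let $0<\alpha<1$ and $0<q<1$. Then the function $x\mapsto \psi_q(x)-\psi_{q^{1/\alpha}}(\alpha x)$ is completely monotonic on $(0,\infty)$, i.e., $$(-1)^n\left[\psi_q^{(n)}(x)-\alpha^n\,\psi_{q^{1/\alpha}}^{(n)}(\alpha x)\right]>0,\qquad 0<x<\infty,\quad n=0,1,\dots.$$
   Context: For $0<q<1$ the $q$-gamma function is $\Gamma_q(x)=(1-q)^{1-x}\prod_{n=0}^\infty \frac{1-q^{n+1}}{1-q^{n+x}}$, and $\psi_q(x)=\Gamma_q'(x)/\Gamma_q(x)$ is its logarithmic derivative; $\psi_q^{(n)}$ denotes the $n$-th derivative of $\psi_q$ with respect to its argument. Here $\psi_{q^{1/\alpha}}$ is the same function with base $q^{1/\alpha}\in(0,1)$ in place of $q$. *)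

theory Defs
  imports "HOL-Analysis.Analysis"
begin

text \<open>
  The definition is used for \<open>0 < q < 1\<close> and \<open>x > 0\<close>, where all factors are positive and the
  product converges. No meaning is attached to the values outside this range.
\<close>

definition q_Gamma :: "real \<Rightarrow> real \<Rightarrow> real" where
  "q_Gamma q x =
     (1 - q) powr (1 - x) * (\<Prod>n. (1 - q ^ (n + 1)) / (1 - q powr (real n + x)))"

definition q_psi :: "real \<Rightarrow> real \<Rightarrow> real" where
  "q_psi q x = deriv (q_Gamma q) x / q_Gamma q x"

text \<open>
  Intended for open \<open>I\<close>: the iterated derivatives are two-sided. Since \<open>deriv\<close> is total,
  infinite differentiability on \<open>I\<close> has to be required explicitly.
\<close>

definition completely_monotonic_on :: "real set \<Rightarrow> (real \<Rightarrow> real) \<Rightarrow> bool" where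
  "completely_monotonic_on I f \<longleftrightarrow>
     (\<forall>n. \<forall>x\<in>I. (deriv ^^ n) f field_differentiable at x \<and> (-1) ^ n * (deriv ^^ n) f x \<ge> 0)"

end

theory Submission
  imports Defs
begin

text \<open>
  Put \<open>H(z) = \<Sum>k. z^k / (k (1 - q^k))\<close>. The functional equation \<open>H(z) - H(q z) = - ln (1 - z)\<close>
  telescopes to \<open>(\<Prod>n. 1 - q^n z) = exp (- H(z))\<close>, which turns \<open>q_Gamma q x\<close> into
  \<open>(1 - q) powr (1 - x) * exp (H(q powr x) - H(q))\<close> and hence gives
  \<open>q_psi q x = - ln (1 - q) + ln q * (\<Sum>k. (q powr x)^k / (1 - q^k))\<close>. With \<open>p = q powr (1 / \<alpha>)\<close>
  we have \<open>p powr (\<alpha> * x) = q powr x\<close>, so the difference of the two psi functions is the constant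
  \<open>ln (1 - p) - ln (1 - q) > 0\<close> plus a series in \<open>q powr (k * x)\<close> with coefficients
  \<open>ln q * (1 / (1 - q^k) - (1 / \<alpha>) / (1 - q powr (k / \<alpha>)))\<close>. These are positive by Bernoulli's
  inequality, and each \<open>q powr (k * x)\<close> is completely monotonic.
\<close>

section \<open>Termwise differentiation of power series\<close>

text \<open>The Euler operator z d/dz multiplies the k-th coefficient by k. Stating it for
  \<open>D * z\<close> covers z = 0 and matches what the chain rule along \<open>q powr x\<close>
  produces, up to the factor \<open>ln q\<close>.\<close>

lemma power_series_Euler_derivative:
  fixes c :: "nat \<Rightarrow> real"
  assumes sm: "\<And>z. \<bar>z\<bar> < 1 \<Longrightarrow> summable (\<lambda>k. c k * z ^ k)" and z: "\<bar>z\<bar> < 1"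
  shows "summable (\<lambda>k. real k * c k * z ^ k)"
    and "\<exists>D. ((\<lambda>z. \<Sum>k. c k * z ^ k) has_real_derivative D) (at z) \<and>
             D * z = (\<Sum>k. real k * c k * z ^ k)"
proof -
  have sm': "summable (\<lambda>k. diffs c k * z ^ k)"
    by (rule termdiff_converges[where K = 1]) (use sm z in auto)
  from sums_mult2[OF diffs_equiv[OF sm'], of z]
  have "(\<lambda>k. real k * c k * z ^ (k - Suc 0) * z) sums ((\<Sum>k. diffs c k * z ^ k) * z)"
    by simp
  moreover have "real k * c k * z ^ (k - Suc 0) * z = real k * c k * z ^ k" for k
    by (cases k) auto
  ultimately have s: "(\<lambda>k. real k * c k * z ^ k) sums ((\<Sum>k. diffs c k * z ^ k) * z)"
    by simp
  then show "summable (\<lambda>k. real k * c k * z ^ k)"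
    by (simp add: sums_iff)
  have "((\<lambda>z. \<Sum>k. c k * z ^ k) has_real_derivative (\<Sum>k. diffs c k * z ^ k)) (at z)"
    by (rule termdiffs_strong'[where K = 1]) (use sm z in auto)
  with s show "\<exists>D. ((\<lambda>z. \<Sum>k. c k * z ^ k) has_real_derivative D) (at z) \<and>
             D * z = (\<Sum>k. real k * c k * z ^ k)"
    by (auto simp: sums_iff)
qed

lemma powr_in_unit_interval:
  fixes q x :: real
  assumes "0 < q" "q < 1" "0 < x"
  shows "0 < q powr x" "q powr x < 1"
proof -
  show "0 < q powr x" using assms by simp
  show "q powr x < 1" using powr_less_mono2[of x q 1] assms by simp
qed

lemma power_series_powr_derivative:
  fixes c :: "nat \<Rightarrow> real"
  assumes sm: "\<And>z. \<bar>z\<bar> < 1 \<Longrightarrow> summable (\<lambda>k. c k * z ^ k)"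
    and q: "0 < q" "q < 1" and x: "0 < x"
  shows "((\<lambda>x. \<Sum>k. c k * (q powr x) ^ k) has_real_derivative
           ln q * (\<Sum>k. real k * c k * (q powr x) ^ k)) (at x)"
proof -
  have z: "\<bar>q powr x\<bar> < 1" using powr_in_unit_interval[OF q x] by simp
  obtain D where D: "((\<lambda>z. \<Sum>k. c k * z ^ k) has_real_derivative D) (at (q powr x))"
      "D * q powr x = (\<Sum>k. real k * c k * (q powr x) ^ k)"
    using power_series_Euler_derivative(2)[of c, OF sm z] by blast
  have "((\<lambda>x. q powr x) has_real_derivative q powr x * ln q) (at x)"
    using q by (auto intro!: derivative_eq_intros)
  from DERIV_chain2[OF D(1) this] show ?thesis
    unfolding D(2)[symmetric] by (simp only: mult_ac)
qed

section \<open>The q-Pochhammer product and its logarithm\<close>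

lemma summable_power_over_one_minus_power:
  fixes q z :: real
  assumes q: "0 < q" "q < 1" and z: "\<bar>z\<bar> < 1"
  shows "summable (\<lambda>k. 1 / (1 - q ^ k) * z ^ k)"
proof (rule summable_comparison_test')
  show "summable (\<lambda>k. 1 / (1 - q) * \<bar>z\<bar> ^ k)"
    using z by (intro summable_mult summable_geometric) auto
  fix k :: nat
  assume k: "1 \<le> k"
  \<comment> \<open>For k >= 1 the denominators stay at least 1 - q, so a geometric series
    dominates.\<close>
  have "q ^ k \<le> q ^ 1" using q k by (intro power_decreasing) auto
  then have "\<bar>1 / (1 - q ^ k)\<bar> \<le> 1 / (1 - q)"
    using q by (auto simp: field_simps)
  then have "\<bar>1 / (1 - q ^ k)\<bar> * \<bar>z\<bar> ^ k \<le> 1 / (1 - q) * \<bar>z\<bar> ^ k"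
    by (intro mult_right_mono) auto
  then show "norm (1 / (1 - q ^ k) * z ^ k) \<le> 1 / (1 - q) * \<bar>z\<bar> ^ k"
    by (simp only: real_norm_def abs_mult power_abs)
qed

text \<open>The term \<open>k = 0\<close> vanishes because its denominator is \<open>0\<close>.\<close>

definition log_q_series :: "real \<Rightarrow> real \<Rightarrow> real" where
  "log_q_series q z = (\<Sum>k. 1 / (real k * (1 - q ^ k)) * z ^ k)"

lemma summable_log_q_series:
  fixes q z :: real
  assumes q: "0 < q" "q < 1" and z: "\<bar>z\<bar> < 1"
  shows "summable (\<lambda>k. 1 / (real k * (1 - q ^ k)) * z ^ k)"
proof (rule summable_comparison_test')
  show "summable (\<lambda>k. 1 / (1 - q ^ k) * \<bar>z\<bar> ^ k)"
    using summable_power_over_one_minus_power[OF q, of "\<bar>z\<bar>"] z by simp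
  fix k :: nat
  assume k: "1 \<le> k"
  have "q ^ k < 1" using q k by (simp add: power_less_one_iff)
  then have "1 / (real k * (1 - q ^ k)) \<le> 1 / (1 - q ^ k)" "0 \<le> 1 / (real k * (1 - q ^ k))"
    using k mult_right_mono[of 1 "real k" "1 - q ^ k"] by (auto intro!: divide_left_mono)
  then have "\<bar>1 / (real k * (1 - q ^ k))\<bar> * \<bar>z\<bar> ^ k \<le> 1 / (1 - q ^ k) * \<bar>z\<bar> ^ k"
    by (intro mult_right_mono) auto
  then show "norm (1 / (real k * (1 - q ^ k)) * z ^ k) \<le> 1 / (1 - q ^ k) * \<bar>z\<bar> ^ k"
    by (simp only: real_norm_def abs_mult power_abs)
qed

text \<open>The coefficients are made for this: the factor 1 - q^k of z^k - (q z)^k cancels the one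
  in the denominator, leaving the logarithm series.\<close>

lemma log_q_series_shift:
  fixes q z :: real
  assumes q: "0 < q" "q < 1" and z: "\<bar>z\<bar> < 1"
  shows "log_q_series q z - log_q_series q (q * z) = - ln (1 - z)"
proof -
  have qz: "\<bar>q * z\<bar> < 1"
    using q z mult_strict_mono'[of q 1 "\<bar>z\<bar>" 1] by (simp add: abs_mult)
  have "log_q_series q z - log_q_series q (q * z) =
      (\<Sum>k. 1 / (real k * (1 - q ^ k)) * z ^ k - 1 / (real k * (1 - q ^ k)) * (q * z) ^ k)"
    unfolding log_q_series_def
    by (intro suminf_diff summable_log_q_series q z qz)
  also have "\<dots> = (\<Sum>k. z ^ k / real k)"
  proof (rule suminf_cong)
    fix k
    show "1 / (real k * (1 - q ^ k)) * z ^ k - 1 / (real k * (1 - q ^ k)) * (q * z) ^ k = z ^ k / real k"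
    proof (cases "k = 0")
      case False
      define d where "d = 1 - q ^ k"
      have "d \<noteq> 0" using q False by (simp add: d_def power_less_one_iff less_imp_neq)
      moreover have "q ^ k = 1 - d" by (simp add: d_def)
      ultimately show ?thesis
        using False by (simp add: power_mult_distrib left_diff_distrib diff_divide_distrib)
    qed simp
  qed
  also have "\<dots> = - ln (1 - z)"
    using sums_minus[OF ln_series'[of "- z"]] z by (simp add: sums_iff)
  finally show ?thesis .
qed

lemma isCont_log_q_series:
  assumes "0 < q" "q < 1" "\<bar>z\<bar> < 1"
  shows "isCont (log_q_series q) z"
  using power_series_Euler_derivative(2)[of "\<lambda>k. 1 / (real k * (1 - q ^ k))" z]
    summable_log_q_series assms
  unfolding log_q_series_def[abs_def] by (blast intro: DERIV_isCont)

lemma q_Pochhammer_tendsto: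
  fixes q z :: real
  assumes q: "0 < q" "q < 1" and z: "\<bar>z\<bar> < 1"
  shows "(\<lambda>N. \<Prod>n<N. 1 - q ^ n * z) \<longlonglongrightarrow> exp (- log_q_series q z)"
proof -
  have small: "\<bar>q ^ n * z\<bar> < 1" for n
  proof -
    have "q ^ n * \<bar>z\<bar> \<le> 1 * \<bar>z\<bar>" using q by (intro mult_right_mono power_le_one) auto
    then show ?thesis using q z by (simp add: abs_mult)
  qed
  have partial: "(\<Prod>n<N. 1 - q ^ n * z) = exp (log_q_series q (q ^ N * z) - log_q_series q z)" for N
  proof (induction N)
    case (Suc N)
    have "1 - q ^ N * z = exp (ln (1 - q ^ N * z))"
      using small[of N] by simp
    also have "ln (1 - q ^ N * z) = log_q_series q (q ^ Suc N * z) - log_q_series q (q ^ N * z)"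
      using log_q_series_shift[OF q small[of N]] by (simp add: mult.assoc)
    finally show ?case by (simp add: Suc.IH flip: exp_add)
  qed simp
  have "(\<lambda>N. q ^ N * z) \<longlonglongrightarrow> 0"
    using LIMSEQ_realpow_zero[of q] q tendsto_mult_left_zero by fastforce
  then have "(\<lambda>N. log_q_series q (q ^ N * z)) \<longlonglongrightarrow> log_q_series q 0"
    by (intro isCont_tendsto_compose[OF isCont_log_q_series] q) auto
  \<comment> \<open>Since 0^0 = 1, the term k = 0 vanishes only through its coefficient 1/0 =
    0.\<close>
  moreover have "1 / (real k * (1 - q ^ k)) * 0 ^ k = 0" for k
    by (cases k) auto
  then have "log_q_series q 0 = 0"
    by (simp only: log_q_series_def suminf_zero)
  ultimately show ?thesis
    unfolding partial by (auto intro!: tendsto_eq_intros)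
qed

section \<open>Closed forms of the q-gamma and q-psi functions\<close>

lemma q_Gamma_eq:
  fixes q x :: real
  assumes q: "0 < q" "q < 1" and x: "0 < x"
  shows "q_Gamma q x = (1 - q) powr (1 - x) * exp (log_q_series q (q powr x) - log_q_series q q)"
proof -
  note u = powr_in_unit_interval[OF q x]
  \<comment> \<open>Numerator and denominator are the Pochhammer products at z = q and z =
    \<open>q powr x\<close>.\<close>
  have "(\<lambda>N. (\<Prod>n<N. 1 - q ^ n * q) / (\<Prod>n<N. 1 - q ^ n * q powr x)) \<longlonglongrightarrow>
      exp (- log_q_series q q) / exp (- log_q_series q (q powr x))"
    by (intro tendsto_divide q_Pochhammer_tendsto q) (use q u in auto)
  then have "(\<lambda>N. \<Prod>n<N. (1 - q ^ (n + 1)) / (1 - q powr (real n + x))) \<longlonglongrightarrow>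
      exp (log_q_series q (q powr x) - log_q_series q q)"
    using q by (simp add: prod_dividef powr_add powr_realpow mult.commute flip: exp_diff)
  \<comment> \<open>The partial products determine the infinite product because their limit, an
    exponential, is nonzero.\<close>
  then have "(\<Prod>n. (1 - q ^ (n + 1)) / (1 - q powr (real n + x))) =
      exp (log_q_series q (q powr x) - log_q_series q q)"
    by (rule prodinf_eq_prod_lim') simp
  then show ?thesis by (simp add: q_Gamma_def)
qed

text \<open>For 0 < q < 1 and x > 0 this is the n-th derivative of the q-psi function: each
  differentiation multiplies the k-th term by k ln q and kills the constant. The term k = 0 is 0
  through its denominator, also for n = 0, where its numerator is 0^0 = 1.\<close>

definition q_psi_series :: "real \<Rightarrow> nat \<Rightarrow> real \<Rightarrow> real" where
  "q_psi_series q n x =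
     (if n = 0 then - ln (1 - q) else 0) +
     ln q * (\<Sum>k. (real k * ln q) ^ n / (1 - q ^ k) * (q powr x) ^ k)"

lemma q_psi_eq:
  fixes q x :: real
  assumes q: "0 < q" "q < 1" and x: "0 < x"
  shows "q_psi q x = q_psi_series q 0 x"
proof -
  let ?G = "\<lambda>x. (1 - q) powr (1 - x) * exp (log_q_series q (q powr x) - log_q_series q q)"
  have H: "((\<lambda>x. log_q_series q (q powr x)) has_real_derivative
      ln q * (\<Sum>k. real k * (1 / (real k * (1 - q ^ k))) * (q powr x) ^ k)) (at x)"
    unfolding log_q_series_def
    by (rule power_series_powr_derivative) (use summable_log_q_series q x in auto)
  \<comment> \<open>At k = 0 both summands are 0, the left by its factor k and the right by division
    by 0.\<close>
  have "(\<Sum>k. real k * (1 / (real k * (1 - q ^ k))) * (q powr x) ^ k) =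
      (\<Sum>k. 1 / (1 - q ^ k) * (q powr x) ^ k)"
  proof (rule suminf_cong)
    fix k
    show "real k * (1 / (real k * (1 - q ^ k))) * (q powr x) ^ k = 1 / (1 - q ^ k) * (q powr x) ^ k"
      by (cases "k = 0") auto
  qed
  with H have "((\<lambda>x. log_q_series q (q powr x)) has_real_derivative
      ln q * (\<Sum>k. 1 / (1 - q ^ k) * (q powr x) ^ k)) (at x)"
    by simp
  then have "(?G has_real_derivative ?G x * q_psi_series q 0 x) (at x)"
    using q by (auto intro!: derivative_eq_intros simp: q_psi_series_def algebra_simps)
  \<comment> \<open>The closed form is available for x > 0; openness of the half-line carries its
    derivative over to \<open>q_Gamma\<close>.\<close>
  then have "(q_Gamma q has_real_derivative ?G x * q_psi_series q 0 x) (at x)"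
    by (rule has_field_derivative_transform_within_open[of _ _ _ "{0<..}"])
       (use q x q_Gamma_eq in auto)
  then show ?thesis
    using q x by (simp add: q_psi_def DERIV_imp_deriv q_Gamma_eq)
qed

text \<open>Induction on n: each step applies the Euler operator and a factor \<open>ln q\<close>.
  That operator needs summability for all z with absolute value below 1, so z varies in the
  induction.\<close>

lemma summable_q_psi_series:
  fixes q z :: real
  assumes q: "0 < q" "q < 1" and z: "\<bar>z\<bar> < 1"
  shows "summable (\<lambda>k. (real k * ln q) ^ n / (1 - q ^ k) * z ^ k)"
  using z
proof (induction n arbitrary: z)
  case 0
  then show ?case using summable_power_over_one_minus_power[OF q] by simp
next
  case (Suc n)
  from summable_mult[OF power_series_Euler_derivative(1)[OF Suc.IH Suc.prems], of "ln q"]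
  show ?case by (simp add: mult_ac)
qed

lemma has_real_derivative_q_psi_series:
  fixes q x :: real
  assumes q: "0 < q" "q < 1" and x: "0 < x"
  shows "(q_psi_series q n has_real_derivative q_psi_series q (Suc n) x) (at x)"
proof -
  let ?c = "\<lambda>n k. (real k * ln q) ^ n / (1 - q ^ k)"
  have z: "\<bar>q powr x\<bar> < 1" using powr_in_unit_interval[OF q x] by simp
  have d: "((\<lambda>x. \<Sum>k. ?c n k * (q powr x) ^ k) has_real_derivative
      ln q * (\<Sum>k. real k * ?c n k * (q powr x) ^ k)) (at x)"
    by (rule power_series_powr_derivative) (use summable_q_psi_series q x in auto)
  have "ln q * (\<Sum>k. real k * ?c n k * (q powr x) ^ k) =
      (\<Sum>k. ln q * (real k * ?c n k * (q powr x) ^ k))"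
    by (intro suminf_mult[symmetric] power_series_Euler_derivative(1) summable_q_psi_series q z)
  also have "\<dots> = (\<Sum>k. ?c (Suc n) k * (q powr x) ^ k)"
    by (simp add: mult_ac)
  finally have "((\<lambda>x. \<Sum>k. ?c n k * (q powr x) ^ k) has_real_derivative
      (\<Sum>k. ?c (Suc n) k * (q powr x) ^ k)) (at x)"
    using d by simp
  then show ?thesis
    unfolding q_psi_series_def[abs_def] by (auto intro!: derivative_eq_intros)
qed

section \<open>Iterated derivatives\<close>

text \<open>A derivative at a point of an open set depends only on values in that set, so agreement
  on \<open>S\<close> survives every application of \<open>deriv\<close>. The second conclusion
  supplies the differentiability in \<open>completely_monotonic_on\<close>.\<close>

lemma higher_deriv_eq:
  fixes f :: "nat \<Rightarrow> real \<Rightarrow> real"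
  assumes S: "open S" and g: "\<And>x. x \<in> S \<Longrightarrow> g x = f 0 x"
    and f: "\<And>n x. x \<in> S \<Longrightarrow> (f n has_real_derivative f (Suc n) x) (at x)"
    and x: "x \<in> S"
  shows "(deriv ^^ n) g x = f n x"
    and "((deriv ^^ n) g has_real_derivative f (Suc n) x) (at x)"
proof -
  have d: "(h has_real_derivative f (Suc n) y) (at y)"
    if "\<And>x. x \<in> S \<Longrightarrow> h x = f n x" "y \<in> S" for h n y
    by (rule has_field_derivative_transform_within_open[OF f S]) (use that in auto)
  have eq: "(deriv ^^ n) g y = f n y" if "y \<in> S" for n y
    using that
  proof (induction n arbitrary: y)
    case (Suc n)
    then show ?case using d[OF Suc.IH] by (auto intro: DERIV_imp_deriv)
  qed (simp add: g)
  show "(deriv ^^ n) g x = f n x" using eq x .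
  show "((deriv ^^ n) g has_real_derivative f (Suc n) x) (at x)" using d[OF eq x] .
qed

lemma higher_deriv_q_psi:
  assumes "0 < q" "q < 1" "0 < x"
  shows "(deriv ^^ n) (q_psi q) x = q_psi_series q n x"
  by (rule higher_deriv_eq[where S = "{0<..}"])
     (use assms in \<open>auto intro: q_psi_eq has_real_derivative_q_psi_series\<close>)

section \<open>Positivity of the difference\<close>

text \<open>Strict Bernoulli inequality by the mean value theorem: the slope of
  \<open>t powr b\<close> is below b for t between u and 1.\<close>

lemma one_minus_powr_less:
  fixes u b :: real
  assumes u: "0 < u" "u < 1" and b: "1 < b"
  shows "1 - u powr b < b * (1 - u)"
proof -
  have "\<exists>t. u < t \<and> t < 1 \<and> 1 powr b - u powr b = (1 - u) * (b * t powr (b - 1))"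
    by (rule MVT2) (use u in \<open>auto intro!: derivative_eq_intros\<close>)
  then obtain t where t: "u < t" "t < 1" "1 - u powr b = (1 - u) * (b * t powr (b - 1))"
    by auto
  have "t powr (b - 1) < 1"
    using powr_in_unit_interval(2)[of t "b - 1"] t u b by simp
  then have "(1 - u) * (b * t powr (b - 1)) < (1 - u) * (b * 1)"
    using u b by (intro mult_strict_left_mono) auto
  then show ?thesis using t by (simp add: mult_ac)
qed

lemma q_psi_series_difference_pos:
  fixes \<alpha> q x :: real
  assumes \<alpha>: "0 < \<alpha>" "\<alpha> < 1" and q: "0 < q" "q < 1" and x: "0 < x"
  defines "p \<equiv> q powr (1 / \<alpha>)"
  shows "0 < (-1) ^ n * (q_psi_series q n x - \<alpha> ^ n * q_psi_series p n (\<alpha> * x))"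
proof -
  let ?u = "q powr x"
  let ?A = "\<lambda>k. (real k * ln q) ^ n / (1 - q ^ k) * ?u ^ k"
  let ?B = "\<lambda>k. (real k * ln p) ^ n / (1 - p ^ k) * ?u ^ k"
  \<comment> \<open>The prefactor \<alpha>^n cancels against (ln p)^n = (ln q / \<alpha>)^n; the
    remaining 1 / \<alpha> stems from the outer factor \<open>ln p\<close>.\<close>
  let ?d = "\<lambda>k. ln q * (1 / (1 - q ^ k) - 1 / \<alpha> / (1 - p ^ k))"
  let ?e = "(if n = 0 then ln (1 - p) - ln (1 - q) else 0)"
  note u = powr_in_unit_interval[OF q x]
  have p: "0 < p" "p < 1"
    unfolding p_def using powr_in_unit_interval[OF q, of "1 / \<alpha>"] \<alpha> by auto
  have lnq: "ln q < 0" using q by simp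
  have lnp: "ln p = ln q / \<alpha>" using q by (simp add: p_def ln_powr)
  have pu: "p powr (\<alpha> * x) = ?u" using \<alpha> by (simp add: p_def powr_powr)
  have A: "summable ?A" by (rule summable_q_psi_series) (use q u in auto)
  have B: "summable ?B" by (rule summable_q_psi_series) (use p u in auto)
  have coeff: "0 < ?d k" if "0 < k" for k
  proof -
    have qk: "0 < q ^ k" "q ^ k < 1" using q that by (auto simp: power_less_one_iff)
    have pk: "0 < p ^ k" "p ^ k < 1" using p that by (auto simp: power_less_one_iff)
    have "p ^ k = (q ^ k) powr (1 / \<alpha>)"
      using q by (simp add: p_def powr_powr mult.commute flip: powr_realpow)
    then have "1 - p ^ k < 1 / \<alpha> * (1 - q ^ k)"
      using one_minus_powr_less[OF qk, of "1 / \<alpha>"] \<alpha> by simp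
    then have "1 / (1 - q ^ k) < 1 / \<alpha> / (1 - p ^ k)"
      using qk pk \<alpha> by (simp add: field_simps)
    then show ?thesis using lnq by (simp add: mult_neg_neg)
  qed
  have summand: "(-1) ^ n * (ln q * ?A k - \<alpha> ^ n * (ln p * ?B k)) = ?d k * (real k * - ln q) ^ n * ?u ^ k" for k
  proof -
    have "\<alpha> ^ n * (real k * ln p) ^ n = (real k * ln q) ^ n"
      unfolding power_mult_distrib[symmetric] using \<alpha> by (simp add: lnp)
    moreover have "\<alpha> ^ n * (ln p * ?B k) =
        ln p * ((\<alpha> ^ n * (real k * ln p) ^ n) * (1 / (1 - p ^ k)) * ?u ^ k)"
      by simp
    ultimately have "\<alpha> ^ n * (ln p * ?B k) =
        ln q * ((real k * ln q) ^ n * (1 / \<alpha> / (1 - p ^ k)) * ?u ^ k)"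
      by (simp add: lnp)
    moreover have "(real k * - ln q) ^ n = (-1) ^ n * (real k * ln q) ^ n"
      unfolding power_mult_distrib[symmetric] by simp
    ultimately show ?thesis by (simp add: algebra_simps)
  qed
  have summand_pos: "0 < (-1) ^ n * (ln q * ?A k - \<alpha> ^ n * (ln p * ?B k))" if "0 < k" for k
    unfolding summand
    by (intro mult_pos_pos[OF mult_pos_pos[OF coeff[OF that]]] zero_less_power)
       (use that q u in \<open>auto intro: mult_pos_neg\<close>)
  have "(-1) ^ n * (q_psi_series q n x - \<alpha> ^ n * q_psi_series p n (\<alpha> * x)) =
      ?e + (-1) ^ n * (ln q * suminf ?A - \<alpha> ^ n * (ln p * suminf ?B))"
    unfolding q_psi_series_def pu by (auto simp: algebra_simps)
  also have "(-1) ^ n * (ln q * suminf ?A - \<alpha> ^ n * (ln p * suminf ?B)) =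
      (\<Sum>k. (-1) ^ n * (ln q * ?A k - \<alpha> ^ n * (ln p * ?B k)))"
    by (rule sums_unique) (intro sums_mult sums_diff summable_sums A B)
  also have "0 < ?e + \<dots>"
  \<comment> \<open>For n >= 1 the constant is 0, so strictness is taken from the series.\<close>
  proof (rule add_nonneg_pos)
    have "p \<le> q"
      using powr_mono'[of 1 "1 / \<alpha>" q] \<alpha> q by (simp add: p_def)
    then show "0 \<le> ?e" using p q by simp
  next
    show "0 < (\<Sum>k. (-1) ^ n * (ln q * ?A k - \<alpha> ^ n * (ln p * ?B k)))"
    \<comment> \<open>The term k = 0 is 0 by division by 0; the first positive one has index
      1.\<close>
    proof (rule suminf_pos2[where i = 1])
      show "summable (\<lambda>k. (-1) ^ n * (ln q * ?A k - \<alpha> ^ n * (ln p * ?B k)))"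
        by (intro summable_mult summable_diff A B)
      show "0 \<le> (-1) ^ n * (ln q * ?A k - \<alpha> ^ n * (ln p * ?B k))" for k
      proof (cases "k = 0")
        case False
        then show ?thesis using summand_pos[of k] by (intro less_imp_le) simp
      qed simp
      show "0 < (-1) ^ n * (ln q * ?A 1 - \<alpha> ^ n * (ln p * ?B 1))"
        by (rule summand_pos) simp
    qed
  qed
  finally show ?thesis .
qed

theorem theorem3p1:
  fixes \<alpha> q :: real
  assumes "0 < \<alpha>" "\<alpha> < 1" and "0 < q" "q < 1"
  shows "completely_monotonic_on {0<..} (\<lambda>x. q_psi q x - q_psi (q powr (1 / \<alpha>)) (\<alpha> * x)) \<and>
    (\<forall>n. \<forall>x>0. (-1) ^ n *
       ((deriv ^^ n) (q_psi q) x - \<alpha> ^ n * (deriv ^^ n) (q_psi (q powr (1 / \<alpha>))) (\<alpha> * x)) > 0)"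
proof -
  define p where "p = q powr (1 / \<alpha>)"
  define f where "f n x = q_psi_series q n x - \<alpha> ^ n * q_psi_series p n (\<alpha> * x)" for n x
  have p: "0 < p" "p < 1"
    unfolding p_def using powr_in_unit_interval[OF assms(3,4), of "1 / \<alpha>"] assms by auto
  have pos: "0 < (-1) ^ n * f n x" if "0 < x" for n x
    using q_psi_series_difference_pos[OF assms that] by (simp add: f_def p_def)
  have f: "(f n has_real_derivative f (Suc n) x) (at x)" if "0 < x" for n x
  proof -
    \<comment> \<open>The inner derivative \<alpha> raises \<alpha>^n to the next power.\<close>
    have "((\<lambda>x. \<alpha> * x) has_real_derivative \<alpha>) (at x)"
      by (auto intro!: derivative_eq_intros)
    from DERIV_chain2[OF has_real_derivative_q_psi_series[OF p] this]
    have "((\<lambda>x. q_psi_series p n (\<alpha> * x)) has_real_derivative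
        q_psi_series p (Suc n) (\<alpha> * x) * \<alpha>) (at x)"
      using that assms by simp
    then show ?thesis
      unfolding f_def[abs_def]
      by (auto intro!: derivative_eq_intros has_real_derivative_q_psi_series assms that)
  qed
  let ?g = "\<lambda>x. q_psi q x - q_psi p (\<alpha> * x)"
  have g: "?g x = f 0 x" if "0 < x" for x
    using that assms p by (simp add: f_def q_psi_eq)
  have "(deriv ^^ n) ?g x = f n x" "((deriv ^^ n) ?g has_real_derivative f (Suc n) x) (at x)"
    if "0 < x" for n x
    by (rule higher_deriv_eq[where S = "{0<..}"]; use g f that in simp)+
  then have "completely_monotonic_on {0<..} ?g"
    unfolding completely_monotonic_on_def field_differentiable_def
    using pos by (fastforce intro: less_imp_le)
  \<comment> \<open>\<open>f n\<close> is also the combination of the separately taken derivatives,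
    so the strict bound \<open>pos\<close> serves both claims.\<close>
  moreover have "0 < (-1) ^ n * ((deriv ^^ n) (q_psi q) x - \<alpha> ^ n * (deriv ^^ n) (q_psi p) (\<alpha> * x))"
    if "0 < x" for n x
    using pos[OF that] that assms p by (simp add: f_def higher_deriv_q_psi)
  ultimately show ?thesis by (simp add: p_def)
qed

end
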